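(* If $G$ is a Left dead end with exactly one good option $G'$, then $\ell(G)=\ell(G')+1$.
   Context: All games are short partizan combinatorial game forms; $G+H$ is the disjunctive sum. Play is misère (a player unable to move wins). Misère outcome classes are ordered $\mathscr L>\mathscr P>\mathscr R$ and $\mathscr L>\mathscr N>\mathscr R$; $G\geq H$ means that for every game $X$ the misère outcome of $G+X$ is $\geq$ that of $H+X$, $G=H$ means $G\ge H$ and $H\ge G$, and $G>H$ means $G\ge H$ and $G\ne H$. A Left dead end is a game no subposition of which (including itself) has a Left option; its options are its Right options. An option $G'$ of $G$ is good if there is no option $G''$ of $G$ with $G'>G''$; "exactly one good option" means all good options are equal to $G'$. An atom is a Left dead end $A\neq0=\{\cdot\mid\cdot\}$ such that $A=H+K$ with Left dead ends $H,K$ implies $H=0$ or $K=0$. A factorisation of $G$ is an expression $G=A_1+\dots+A_k$ with atoms $A_i$ ($k\ge0$), of length $k$; $\ell(G)$ denotes the length of a longest factorisation of $G$ (so $\ell(0)=0$). *)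

theory Defs
  imports "HOL-Library.FSet"
begin

datatype game = Game (left_opts: "game fset") (right_opts: "game fset")

lemma size_left_opts: "g |\<in>| left_opts G \<Longrightarrow> size g < size G"
  by (cases G) (auto simp: less_Suc_eq_le sum.remove[of _ g])

lemma size_right_opts: "g |\<in>| right_opts G \<Longrightarrow> size g < size G"
  by (cases G) (auto simp: less_Suc_eq_le sum.remove[of _ g])

section \<open>Disjunctive sum\<close>

instantiation game :: "{zero, plus}"
begin

definition zero_game :: game where
  "0 = Game {||} {||}"

function plus_game :: "game \<Rightarrow> game \<Rightarrow> game" where
  "plus_game G H =
     Game ((\<lambda>g. plus_game g H) |`| left_opts G |\<union>| (\<lambda>h. plus_game G h) |`| left_opts H)
          ((\<lambda>g. plus_game g H) |`| right_opts G |\<union>| (\<lambda>h. plus_game G h) |`| right_opts H)"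
  by pat_completeness auto
termination
  by (relation "measure (\<lambda>(G, H). size G + size H)")
     (auto dest: size_left_opts size_right_opts)

instance ..

end

declare plus_game.simps [simp del]

lemma game_induct:
  assumes "\<And>G. (\<And>g. g |\<in>| left_opts G \<Longrightarrow> P g) \<Longrightarrow> (\<And>g. g |\<in>| right_opts G \<Longrightarrow> P g) \<Longrightarrow> P G"
  shows "P (G :: game)"
  by (induction G rule: measure_induct_rule[of size]) (blast intro: assms size_left_opts size_right_opts)

lemma left_opts_plus:
  "left_opts (G + H) = (\<lambda>g. g + H) |`| left_opts G |\<union>| (\<lambda>h. G + h) |`| left_opts H"
  by (simp add: plus_game.simps[of G H])

lemma right_opts_plus:
  "right_opts (G + H) = (\<lambda>g. g + H) |`| right_opts G |\<union>| (\<lambda>h. G + h) |`| right_opts H"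
  by (simp add: plus_game.simps[of G H])

lemma opts_zero [simp]: "left_opts 0 = {||}" "right_opts 0 = {||}"
  by (simp_all add: zero_game_def)

instance game :: comm_monoid_add
proof
  fix a b c :: game
  show "a + b + c = a + (b + c)"
  proof (induction "size a + size b + size c" arbitrary: a b c rule: less_induct)
    case less
    have "left_opts (a + b + c) = left_opts (a + (b + c))"
      unfolding left_opts_plus fimage_funion fset.map_comp comp_def funion_assoc
      by (intro arg_cong2[of _ _ _ _ "(|\<union>|)"] fset.map_cong refl less size_left_opts)
        (auto dest: size_left_opts)
    moreover have "right_opts (a + b + c) = right_opts (a + (b + c))"
      unfolding right_opts_plus fimage_funion fset.map_comp comp_def funion_assoc
      by (intro arg_cong2[of _ _ _ _ "(|\<union>|)"] fset.map_cong refl less size_right_opts)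
        (auto dest: size_right_opts)
    ultimately show ?case by (simp add: game.expand)
  qed
  show "a + b = b + a"
  proof (induction "size a + size b" arbitrary: a b rule: less_induct)
    case less
    have "left_opts (a + b) = left_opts (b + a)"
      unfolding left_opts_plus
      by (subst funion_commute) (auto simp: less size_left_opts intro!: arg_cong2[of _ _ _ _ "(|\<union>|)"] fset.map_cong)
    moreover have "right_opts (a + b) = right_opts (b + a)"
      unfolding right_opts_plus
      by (subst funion_commute) (auto simp: less size_right_opts intro!: arg_cong2[of _ _ _ _ "(|\<union>|)"] fset.map_cong)
    ultimately show ?case by (simp add: game.expand)
  qed
  show "0 + a = a"
  proof (induction a rule: game_induct)
    case (1 G)
    have "left_opts (0 + G) = left_opts G" "right_opts (0 + G) = right_opts G"
      using 1 by (simp_all add: left_opts_plus right_opts_plus cong: fset.map_cong)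
    then show ?case by (simp add: game.expand)
  qed
qed

section \<open>Misere outcomes\<close>

text \<open>Whether the player to move wins; the first disjunct is the misere convention.\<close>

function left_wins_first :: "game \<Rightarrow> bool" and right_wins_first :: "game \<Rightarrow> bool" where
  "left_wins_first G \<longleftrightarrow>
     left_opts G = {||} \<or> (\<exists>g \<in> fset (left_opts G). \<not> right_wins_first g)"
| "right_wins_first G \<longleftrightarrow>
     right_opts G = {||} \<or> (\<exists>g \<in> fset (right_opts G). \<not> left_wins_first g)"
  by pat_completeness auto
termination
  by (relation "measure (\<lambda>x. case x of Inl G \<Rightarrow> size G | Inr G \<Rightarrow> size G)")
     (auto dest: size_left_opts size_right_opts)

declare left_wins_first.simps [simp del] right_wins_first.simps [simp del]

datatype outcome = OutL | OutP | OutN | OutR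

instantiation outcome :: order
begin

definition less_eq_outcome :: "outcome \<Rightarrow> outcome \<Rightarrow> bool" where
  "x \<le> y \<longleftrightarrow> x = y \<or> x = OutR \<or> y = OutL"

definition less_outcome :: "outcome \<Rightarrow> outcome \<Rightarrow> bool" where
  "x < y \<longleftrightarrow> x \<le> y \<and> x \<noteq> (y :: outcome)"

instance
  by standard (auto simp: less_eq_outcome_def less_outcome_def)

end

definition misere_outcome :: "game \<Rightarrow> outcome" where
  "misere_outcome G =
     (if left_wins_first G then (if right_wins_first G then OutN else OutL)
      else (if right_wins_first G then OutR else OutP))"

section \<open>Comparison modulo all games\<close>

text \<open>HOL equality on \<^typ>\<open>game\<close> is identity of forms; the equality of game values is
  \<open>\<approx>\<close>.\<close>

definition game_ge :: "game \<Rightarrow> game \<Rightarrow> bool"  (infix "\<succeq>" 50) where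
  "G \<succeq> H \<longleftrightarrow> (\<forall>X. misere_outcome (G + X) \<ge> misere_outcome (H + X))"

definition game_eq :: "game \<Rightarrow> game \<Rightarrow> bool"  (infix "\<approx>" 50) where
  "G \<approx> H \<longleftrightarrow> G \<succeq> H \<and> H \<succeq> G"

definition game_gt :: "game \<Rightarrow> game \<Rightarrow> bool"  (infix "\<succ>" 50) where
  "G \<succ> H \<longleftrightarrow> G \<succeq> H \<and> \<not> G \<approx> H"

section \<open>Left dead ends, atoms and factorisations\<close>

inductive subposition :: "game \<Rightarrow> game \<Rightarrow> bool" where
  self: "subposition G G"
| left: "subposition H G \<Longrightarrow> h |\<in>| left_opts H \<Longrightarrow> subposition h G"
| right: "subposition H G \<Longrightarrow> h |\<in>| right_opts H \<Longrightarrow> subposition h G"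

definition left_dead_end :: "game \<Rightarrow> bool" where
  "left_dead_end G \<longleftrightarrow> (\<forall>H. subposition H G \<longrightarrow> left_opts H = {||})"

text \<open>Only used for Left dead ends, whose options are their Right options.\<close>

definition good_option :: "game \<Rightarrow> game \<Rightarrow> bool" where
  "good_option G G' \<longleftrightarrow>
     G' |\<in>| right_opts G \<and> \<not> (\<exists>G''. G'' |\<in>| right_opts G \<and> G' \<succ> G'')"

definition atom :: "game \<Rightarrow> bool" where
  "atom A \<longleftrightarrow> left_dead_end A \<and> \<not> A \<approx> 0 \<and>
     (\<forall>H K. left_dead_end H \<longrightarrow> left_dead_end K \<longrightarrow> A \<approx> H + K \<longrightarrow> H \<approx> 0 \<or> K \<approx> 0)"

definition factorisation :: "game \<Rightarrow> game list \<Rightarrow> bool" where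
  "factorisation G As \<longleftrightarrow> (\<forall>A \<in> set As. atom A) \<and> G \<approx> sum_list As"

text \<open>Meaningful when \<open>G\<close> has a factorisation and their lengths are bounded, as is the case for
  every Left dead end.\<close>

definition longest_length :: "game \<Rightarrow> nat"  ("\<ell>") where
  "\<ell> G = Max {length As | As. factorisation G As}"

end

theory Submission
  imports Defs
begin

text \<open>On Left dead ends, \<open>G \<succeq> H\<close> holds iff every option of \<open>G\<close> dominates some option of \<open>H\<close>, and
  \<open>H\<close> is zero if \<open>G\<close> is. Hence \<open>g + {\<cdot>|0} \<succeq> G\<close> for every option \<open>g\<close> of \<open>G\<close>, by induction,
  and a Left dead end with the single good option \<open>G'\<close> equals \<open>G' + {\<cdot>|0}\<close>, which makes its
  longest factorisation longer than that of \<open>G'\<close>. Conversely, if \<open>G = A\<^sub>1 + \<dots> + A\<^sub>k\<close>, then \<open>G'\<close>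
  equals some option of this sum; such an option changes one \<open>A\<^sub>i\<close> only, so it has a
  factorisation of length at least \<open>k - 1\<close>.\<close>

section \<open>Left dead ends: recursive description and closure under sums\<close>

lemma left_dead_end_iff:
  "left_dead_end G \<longleftrightarrow> left_opts G = {||} \<and> (\<forall>g. g |\<in>| right_opts G \<longrightarrow> left_dead_end g)"
proof
  have trans: "subposition K H" if "subposition K g" "subposition g H" for K g H
    using that by induction (auto intro: subposition.intros)
  show "left_opts G = {||} \<and> (\<forall>g. g |\<in>| right_opts G \<longrightarrow> left_dead_end g)" if "left_dead_end G"
    using that unfolding left_dead_end_def by (meson trans subposition.intros)
next
  assume G: "left_opts G = {||} \<and> (\<forall>g. g |\<in>| right_opts G \<longrightarrow> left_dead_end g)"
  have "H = G \<or> (\<exists>g. g |\<in>| right_opts G \<and> subposition H g)" if "subposition H G" for H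
    using that G by induction (auto intro: subposition.intros)
  then show "left_dead_end G"
    using G unfolding left_dead_end_def by blast
qed

lemma left_dead_endD:
  assumes "left_dead_end G"
  shows "left_opts G = {||}" "g |\<in>| right_opts G \<Longrightarrow> left_dead_end g"
  using assms left_dead_end_iff by blast+

lemma left_dead_end_zero: "left_dead_end 0"
  by (simp add: left_dead_end_iff[of 0])

lemma left_dead_end_plus:
  "left_dead_end G \<Longrightarrow> left_dead_end H \<Longrightarrow> left_dead_end (G + H)"
proof (induction "size G + size H" arbitrary: G H rule: less_induct)
  case less
  have "left_dead_end (g + H)" if "g |\<in>| right_opts G" for g
    using less size_right_opts[OF that] left_dead_endD(2)[OF _ that] by simp
  moreover have "left_dead_end (G + h)" if "h |\<in>| right_opts H" for h
    using less size_right_opts[OF that] left_dead_endD(2)[OF _ that] by simp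
  ultimately show ?case
    using less.prems[THEN left_dead_endD(1)]
    by (subst left_dead_end_iff) (auto simp: left_opts_plus right_opts_plus)
qed

lemma left_dead_end_sum_list:
  "(\<And>A. A \<in> set As \<Longrightarrow> left_dead_end A) \<Longrightarrow> left_dead_end (sum_list As)"
  by (induction As) (auto simp: left_dead_end_zero left_dead_end_plus)

lemma left_dead_end_nonzero:
  assumes "left_dead_end G" "G \<noteq> 0"
  shows "right_opts G \<noteq> {||}"
  using assms by (metis game.expand left_dead_endD(1) opts_zero)

section \<open>Comparison of Left dead ends\<close>

lemma game_ge_iff:
  "G \<succeq> H \<longleftrightarrow> (\<forall>X. (left_wins_first (H + X) \<longrightarrow> left_wins_first (G + X)) \<and>
     (right_wins_first (G + X) \<longrightarrow> right_wins_first (H + X)))"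
  unfolding game_ge_def misere_outcome_def less_eq_outcome_def by (auto split: if_splits)

lemma game_ge_refl [simp]: "G \<succeq> G"
  by (simp add: game_ge_iff)

lemma game_ge_trans: "G \<succeq> H \<Longrightarrow> H \<succeq> K \<Longrightarrow> G \<succeq> K"
  unfolding game_ge_iff by blast

lemma game_ge_plus_right: "G \<succeq> H \<Longrightarrow> G + K \<succeq> H + K"
  unfolding game_ge_def by (simp add: add.assoc)

lemma game_eq_refl [simp]: "G \<approx> G"
  by (simp add: game_eq_def)

lemma game_eq_trans: "G \<approx> H \<Longrightarrow> H \<approx> K \<Longrightarrow> G \<approx> K"
  unfolding game_eq_def using game_ge_trans by blast

lemma game_eq_plus: "G \<approx> G' \<Longrightarrow> H \<approx> H' \<Longrightarrow> G + H \<approx> G' + H'"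
  unfolding game_eq_def by (metis game_ge_plus_right game_ge_trans add.commute)

lemma left_wins_first_plus:
  assumes "left_dead_end G"
  shows "left_wins_first (G + X) \<longleftrightarrow>
    left_opts X = {||} \<or> (\<exists>x. x |\<in>| left_opts X \<and> \<not> right_wins_first (G + x))"
  by (subst left_wins_first.simps) (auto simp: left_opts_plus left_dead_endD(1)[OF assms])

lemma right_wins_first_plus:
  "right_wins_first (G + X) \<longleftrightarrow> right_opts G = {||} \<and> right_opts X = {||} \<or>
    (\<exists>g. g |\<in>| right_opts G \<and> \<not> left_wins_first (g + X)) \<or>
    (\<exists>x. x |\<in>| right_opts X \<and> \<not> left_wins_first (G + x))"
  by (subst right_wins_first.simps) (auto simp: right_opts_plus)

lemma right_wins_first_left_dead_end_iff:
  assumes "left_dead_end G"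
  shows "right_wins_first G \<longleftrightarrow> right_opts G = {||}"
proof -
  have "left_wins_first g" if "g |\<in>| right_opts G" for g
    using left_dead_endD(1)[OF left_dead_endD(2)[OF assms that]] by (subst left_wins_first.simps) simp
  then show ?thesis by (subst right_wins_first.simps) blast
qed

fun left_int :: "nat \<Rightarrow> game" where
  "left_int 0 = 0"
| "left_int (Suc n) = Game {|left_int n|} {||}"

text \<open>Left can only spend the moves of \<open>left_int n\<close>, Right only those of
  \<open>G\<close>. As \<open>G\<close> allows fewer than \<open>size G\<close> moves in a row,
  Right runs out of moves first and so wins.\<close>

lemma right_wins_first_plus_left_int:
  "left_dead_end G \<Longrightarrow> size G \<le> n \<Longrightarrow> right_wins_first (G + left_int n)"
proof (induction n arbitrary: G)
  case 0
  then show ?case by (cases G) simp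
next
  case (Suc n)
  show ?case
  proof (cases "right_opts G = {||}")
    case True
    then show ?thesis by (simp add: right_wins_first_plus)
  next
    case False
    then obtain g where g: "g |\<in>| right_opts G" by blast
    then have "right_wins_first (g + left_int n)"
      using Suc.prems left_dead_endD(2) size_right_opts[OF g] by (intro Suc.IH) auto
    then have "\<not> left_wins_first (g + left_int (Suc n))"
      using left_wins_first_plus[OF left_dead_endD(2)[OF Suc.prems(1) g]] by simp
    then show ?thesis
      using g right_wins_first_plus by blast
  qed
qed

text \<open>Left moves only in the test game, so if Left moving first tells the two apart, then
  Right moving first does so on some Left option of the test game.\<close>

lemma not_game_geE:
  assumes "left_dead_end G" "left_dead_end H" "\<not> G \<succeq> H"
  obtains X where "right_wins_first (G + X)" "\<not> right_wins_first (H + X)"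
proof -
  obtain Z where Z: "left_wins_first (H + Z) \<and> \<not> left_wins_first (G + Z) \<or>
      right_wins_first (G + Z) \<and> \<not> right_wins_first (H + Z)"
    using assms(3) unfolding game_ge_iff by blast
  then show thesis
  proof
    assume "left_wins_first (H + Z) \<and> \<not> left_wins_first (G + Z)"
    then show thesis
      using left_wins_first_plus[OF assms(1)] left_wins_first_plus[OF assms(2)] that by blast
  qed (use that in blast)
qed

text \<open>From right to left, Right copies a winning move from \<open>G + X\<close> to
  \<open>H + X\<close>, replacing a move to \<open>g\<close> by one to a dominated \<open>h\<close>.
  Conversely, test games separating \<open>g\<close> from each \<open>h\<close> are assembled into
  one.\<close>

theorem left_dead_end_ge_iff:
  assumes G: "left_dead_end G" and H: "left_dead_end H"
  shows "G \<succeq> H \<longleftrightarrow> (right_opts G = {||} \<longrightarrow> right_opts H = {||}) \<and>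
    (\<forall>g. g |\<in>| right_opts G \<longrightarrow> (\<exists>h. h |\<in>| right_opts H \<and> g \<succeq> h))" (is "_ \<longleftrightarrow> ?R")
proof
  assume R: ?R
  have "(left_wins_first (H + X) \<longrightarrow> left_wins_first (G + X)) \<and>
      (right_wins_first (G + X) \<longrightarrow> right_wins_first (H + X))" for X
  proof (induction X rule: game_induct)
    case (1 X)
    have "left_wins_first (H + X) \<longrightarrow> left_wins_first (G + X)"
      using 1 left_wins_first_plus[OF G] left_wins_first_plus[OF H] by blast
    moreover have "right_wins_first (H + X)" if "right_wins_first (G + X)"
    proof -
      consider "right_opts G = {||}" "right_opts X = {||}"
        | g where "g |\<in>| right_opts G" "\<not> left_wins_first (g + X)"
        | x where "x |\<in>| right_opts X" "\<not> left_wins_first (G + x)"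
        using \<open>right_wins_first (G + X)\<close> unfolding right_wins_first_plus[of G X] by blast
      then show ?thesis
      proof cases
        case 1
        then show ?thesis using R right_wins_first_plus by blast
      next
        case 2
        then obtain h where "h |\<in>| right_opts H" "g \<succeq> h" using R by blast
        then show ?thesis
          using 2 right_wins_first_plus unfolding game_ge_iff by blast
      next
        case 3
        then show ?thesis using 1 right_wins_first_plus by blast
      qed
    qed
    ultimately show ?case by blast
  qed
  then show "G \<succeq> H" unfolding game_ge_iff by blast
next
  assume ge: "G \<succeq> H"
  have "right_opts H = {||}" if "right_opts G = {||}"
    using ge that right_wins_first_left_dead_end_iff[OF G] right_wins_first_left_dead_end_iff[OF H]
    unfolding game_ge_iff by (metis add.right_neutral)
  moreover have "\<exists>h. h |\<in>| right_opts H \<and> g \<succeq> h" if g: "g |\<in>| right_opts G" for g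
  proof (rule ccontr)
    assume "\<not> ?thesis"
    then have "\<forall>h. \<exists>X. h |\<in>| right_opts H \<longrightarrow>
        right_wins_first (g + X) \<and> \<not> right_wins_first (h + X)"
      using not_game_geE left_dead_endD(2)[OF G g] left_dead_endD(2)[OF H] by metis
    then obtain X where X: "\<And>h. h |\<in>| right_opts H \<Longrightarrow>
        right_wins_first (g + X h) \<and> \<not> right_wins_first (h + X h)"
      by metis
    \<comment> \<open>In \<open>H + Y\<close>, Left answers each move to \<open>h\<close> by \<open>X h\<close>, whereas in \<open>G + Y\<close>, Right wins by
      moving to \<open>g\<close>. The Left option \<open>left_int (size g)\<close> and the Right option \<open>0\<close> only matter
      for \<open>H = 0\<close>: they ensure that \<open>Y\<close> is neither a Left end nor a Right end.\<close>
    define Y where "Y = Game (finsert (left_int (size g)) (X |`| right_opts H)) {|0|}"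
    have "\<not> left_wins_first (g + Y)"
      using X right_wins_first_plus_left_int[of g "size g"] left_dead_endD(2)[OF G g]
      by (auto simp: left_wins_first_plus Y_def)
    then have "right_wins_first (G + Y)"
      using g right_wins_first_plus by blast
    have "left_wins_first (h + Y)" if "h |\<in>| right_opts H" for h
      using X[OF that] that left_dead_endD(2)[OF H that]
      by (auto simp: left_wins_first_plus Y_def)
    \<comment> \<open>\<open>H\<close> is what remains when Right takes the option \<open>0\<close>
      of \<open>Y\<close>.\<close>
    moreover have "left_wins_first H"
      using left_dead_endD(1)[OF H] by (subst left_wins_first.simps) simp
    ultimately have "\<not> right_wins_first (H + Y)"
      unfolding right_wins_first_plus[of H Y] by (auto simp: Y_def)
    with \<open>right_wins_first (G + Y)\<close> show False using ge unfolding game_ge_iff by blast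
  qed
  ultimately show ?R by blast
qed

lemma left_dead_end_eq_zero_iff:
  assumes "left_dead_end G"
  shows "G \<approx> 0 \<longleftrightarrow> G = 0"
  using left_dead_end_ge_iff[OF left_dead_end_zero assms] left_dead_end_nonzero[OF assms]
  by (auto simp: game_eq_def)

section \<open>Lengths of factorisations\<close>

text \<open>For a Left dead end: the game tree has depth at least \<open>n\<close>. Depth is
  superadditive and respects equality of values, so it bounds the number of nonzero
  summands.\<close>

fun lasts :: "nat \<Rightarrow> game \<Rightarrow> bool" where
  "lasts 0 G \<longleftrightarrow> True"
| "lasts (Suc n) G \<longleftrightarrow> (\<exists>g. g |\<in>| right_opts G \<and> lasts n g)"

lemma lasts_less_size: "lasts n G \<Longrightarrow> n < size G"
proof (induction n arbitrary: G)
  case 0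
  then show ?case by (cases G) simp
next
  case (Suc n)
  then show ?case using size_right_opts by fastforce
qed

text \<open>Each move in \<open>G\<close> is matched in \<open>H\<close> by a move to a dominated
  option, so a run of moves carries over.\<close>

lemma lasts_mono:
  "lasts n G \<Longrightarrow> left_dead_end G \<Longrightarrow> left_dead_end H \<Longrightarrow> G \<succeq> H \<Longrightarrow> lasts n H"
proof (induction n arbitrary: G H)
  case (Suc n)
  then obtain g where "g |\<in>| right_opts G" "lasts n g" by auto
  moreover from this obtain h where "h |\<in>| right_opts H" "g \<succeq> h"
    using Suc.prems left_dead_end_ge_iff by blast
  ultimately show ?case using Suc left_dead_endD(2) by (metis lasts.simps(2))
qed simp

lemma lasts_plus: "lasts m G \<Longrightarrow> lasts n H \<Longrightarrow> lasts (m + n) (G + H)"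
proof (induction m arbitrary: G)
  case 0
  have "lasts n (G + H)" using 0(2)
  proof (induction n arbitrary: H)
    case (Suc n)
    then show ?case by (auto simp: right_opts_plus)
  qed simp
  then show ?case by simp
next
  case (Suc m)
  then show ?case by (auto simp: right_opts_plus)
qed

lemma lasts_one:
  assumes "left_dead_end G" "\<not> G \<approx> 0"
  shows "lasts 1 G"
  using left_dead_end_nonzero[OF assms(1)] assms(2) by force

lemma lasts_sum_list_atoms: "(\<And>A. A \<in> set As \<Longrightarrow> atom A) \<Longrightarrow> lasts (length As) (sum_list As)"
proof (induction As)
  case (Cons A As)
  then have "lasts 1 A" using lasts_one unfolding atom_def by simp
  then show ?case using Cons lasts_plus[of 1 A "length As" "sum_list As"] by simp
qed simp

lemma factorisation_left_dead_end: "factorisation G As \<Longrightarrow> left_dead_end (sum_list As)"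
  unfolding factorisation_def atom_def by (blast intro: left_dead_end_sum_list)

text \<open>Every atom allows a move, so the sum, and with it \<open>G\<close>, allows
  \<open>length As\<close> moves in a row. Hence the maximum in \<open>longest_length\<close> is
  over a finite set.\<close>

lemma factorisation_length_less_size:
  assumes "left_dead_end G" "factorisation G As"
  shows "length As < size G"
proof -
  have "lasts (length As) (sum_list As)"
    using assms(2) lasts_sum_list_atoms unfolding factorisation_def by blast
  then have "lasts (length As) G"
    using lasts_mono assms factorisation_left_dead_end
    unfolding factorisation_def game_eq_def by blast
  then show ?thesis by (rule lasts_less_size)
qed

lemma factorisation_plus:
  "factorisation G As \<Longrightarrow> factorisation H Bs \<Longrightarrow> factorisation (G + H) (As @ Bs)"
  unfolding factorisation_def by (auto intro: game_eq_plus)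

lemma factorisation_cong: "factorisation G As \<Longrightarrow> H \<approx> G \<Longrightarrow> factorisation H As"
  unfolding factorisation_def using game_eq_trans by blast

lemma factorisation_atom: "atom A \<Longrightarrow> factorisation A [A]"
  by (simp add: factorisation_def)

lemma factorisation_exists:
  assumes "left_dead_end G"
  shows "\<exists>As. factorisation G As"
proof -
  \<comment> \<open>Induction on a strict bound \<open>n\<close> for the depth: when a game splits
    into two nonzero summands, each allows a move, so the other one has smaller depth. The bound
    \<open>0\<close> is impossible.\<close>
  have "\<exists>As. factorisation G As" if "left_dead_end G" "\<not> lasts n G" for n
    using that
  proof (induction n arbitrary: G)
    case (Suc n)
    consider "G \<approx> 0" | "atom G"
      | H K where "left_dead_end H" "left_dead_end K" "G \<approx> H + K" "\<not> H \<approx> 0" "\<not> K \<approx> 0"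
      using Suc.prems(1) unfolding atom_def by blast
    then show ?case
    proof cases
      case 1
      then have "factorisation G []" by (simp add: factorisation_def)
      then show ?thesis ..
    next
      case 2
      then show ?thesis using factorisation_atom by blast
    next
      case 3
      have "\<not> lasts (Suc n) (H + K)"
        using 3 Suc.prems lasts_mono left_dead_end_plus unfolding game_eq_def by blast
      then have "\<not> lasts n H" "\<not> lasts n K"
        using lasts_plus[of n H 1 K] lasts_plus[of 1 H n K] lasts_one 3 by auto
      then show ?thesis
        using Suc.IH 3 factorisation_plus factorisation_cong by meson
    qed
  qed simp
  then show ?thesis using assms lasts_less_size by blast
qed

lemma finite_factorisation_lengths:
  assumes "left_dead_end G"
  shows "finite {length As | As. factorisation G As}"
  using factorisation_length_less_size[OF assms] by (auto intro: finite_subset[of _ "{..<size G}"])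

lemma factorisation_length_le:
  assumes "left_dead_end G" "factorisation G As"
  shows "length As \<le> \<ell> G"
  unfolding longest_length_def using finite_factorisation_lengths assms by (auto intro: Max_ge)

lemma longest_factorisation:
  assumes "left_dead_end G"
  obtains As where "factorisation G As" "length As = \<ell> G"
proof -
  have "\<ell> G \<in> {length As | As. factorisation G As}"
    unfolding longest_length_def
    using finite_factorisation_lengths[OF assms] factorisation_exists[OF assms]
    by (intro Max_in) auto
  then show thesis using that by auto
qed

lemma sum_of_atoms_option_factorisation:
  assumes "\<And>A. A \<in> set As \<Longrightarrow> atom A" "s |\<in>| right_opts (sum_list As)"
  shows "\<exists>Bs. factorisation s Bs \<and> length As \<le> length Bs + 1"
  using assms
proof (induction As arbitrary: s)
  case (Cons A As)
  have A: "atom A" and As: "factorisation (sum_list As) As"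
    using Cons.prems(1) by (auto simp: factorisation_def)
  consider a where "a |\<in>| right_opts A" "s = a + sum_list As"
    | t where "t |\<in>| right_opts (sum_list As)" "s = A + t"
    using Cons.prems(2) by (auto simp: right_opts_plus)
  then show ?case
  proof cases
    case 1
    \<comment> \<open>\<open>Cs\<close> may be empty, which is why the length can drop by
      one.\<close>
    then obtain Cs where "factorisation a Cs"
      using A factorisation_exists left_dead_endD(2) unfolding atom_def by blast
    then have "factorisation s (Cs @ As)" using 1 As factorisation_plus by blast
    then show ?thesis by force
  next
    case 2
    then obtain Bs where "factorisation t Bs" "length As \<le> length Bs + 1"
      using Cons by auto
    then show ?thesis
      using factorisation_plus[OF factorisation_atom[OF A], of t Bs] 2 by (intro exI[of _ "A # Bs"]) simp
  qed
qed simp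

section \<open>A single good option\<close>

definition minus_one :: game where
  "minus_one = Game {||} {|0|}"

lemma right_opts_minus_one [simp]: "right_opts minus_one = {|0|}"
  by (simp add: minus_one_def)

lemma left_dead_end_minus_one: "left_dead_end minus_one"
  by (subst left_dead_end_iff) (simp add: minus_one_def left_dead_end_zero)

text \<open>Two nonzero summands would allow two moves in a row, but \<open>minus_one\<close> allows
  only one.\<close>

lemma atom_minus_one: "atom minus_one"
  unfolding atom_def
proof (intro conjI allI impI)
  show "\<not> minus_one \<approx> 0"
    using left_dead_end_eq_zero_iff[OF left_dead_end_minus_one] right_opts_minus_one
    by (metis finsert_not_fempty opts_zero(2))
  fix H K
  assume HK: "left_dead_end H" "left_dead_end K" "minus_one \<approx> H + K"
  show "H \<approx> 0 \<or> K \<approx> 0"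
  proof (rule ccontr)
    assume "\<not> (H \<approx> 0 \<or> K \<approx> 0)"
    then have "lasts (1 + 1) (H + K)" using HK lasts_one lasts_plus by blast
    then have "lasts (1 + 1) minus_one"
      using HK lasts_mono left_dead_end_minus_one left_dead_end_plus
      unfolding game_eq_def by blast
    then show False by simp
  qed
qed (rule left_dead_end_minus_one)

text \<open>The options of \<open>g + minus_one\<close> are \<open>g\<close>, itself an option of
  \<open>G\<close>, and \<open>g' + minus_one\<close> for options \<open>g'\<close> of
  \<open>g\<close>, each of which dominates \<open>g\<close> by induction.\<close>

lemma option_plus_minus_one_ge:
  "left_dead_end G \<Longrightarrow> g |\<in>| right_opts G \<Longrightarrow> g + minus_one \<succeq> G"
proof (induction g arbitrary: G rule: game_induct)
  case (1 g)
  have g: "left_dead_end g" using 1 left_dead_endD by blast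
  have "\<exists>h. h |\<in>| right_opts G \<and> k \<succeq> h" if "k |\<in>| right_opts (g + minus_one)" for k
    using that 1(2)[OF _ g] 1(4) by (auto simp: right_opts_plus)
  then show ?case
    using left_dead_end_ge_iff[of "g + minus_one" G] g 1(3)
    by (simp add: right_opts_plus left_dead_end_plus left_dead_end_minus_one)
qed

text \<open>Every option of \<open>G\<close> dominates \<open>G'\<close>, which is an option of
  \<open>G' + minus_one\<close>; the other comparison holds for any option of
  \<open>G\<close>.\<close>

lemma eq_least_option_plus_minus_one:
  assumes "left_dead_end G" "G' |\<in>| right_opts G" "\<And>g. g |\<in>| right_opts G \<Longrightarrow> g \<succeq> G'"
  shows "G \<approx> G' + minus_one"
proof -
  have G': "left_dead_end G'" "left_dead_end (G' + minus_one)"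
    using assms left_dead_endD left_dead_end_plus left_dead_end_minus_one by blast+
  have "G \<succeq> G' + minus_one"
    using left_dead_end_ge_iff[OF assms(1) G'(2)] assms by (auto simp: right_opts_plus)
  then show ?thesis
    using option_plus_minus_one_ge[OF assms(1,2)] by (simp add: game_eq_def)
qed

text \<open>By finiteness, the options that \<open>h\<close> dominates include a minimal
  one.\<close>

lemma option_ge_good_option:
  assumes "h |\<in>| right_opts G"
  obtains g where "good_option G g" "h \<succeq> g"
proof -
  let ?A = "{x \<in> fset (right_opts G). h \<succeq> x}"
  have "\<exists>g\<in>?A. \<forall>x\<in>?A. x \<noteq> g \<longrightarrow> \<not> g \<succ> x"
    using assms
    by (intro Finite_Set.bex_min_element)
      (auto simp: transp_on_def asymp_on_def game_gt_def game_eq_def intro: game_ge_trans)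
  then obtain g where "g \<in> ?A" "\<forall>x\<in>?A. x \<noteq> g \<longrightarrow> \<not> g \<succ> x" by blast
  \<comment> \<open>An option strictly below \<open>g\<close> would again be dominated by
    \<open>h\<close>, so \<open>g\<close> is minimal among all options.\<close>
  moreover from this have "\<not> g \<succ> x" if "x |\<in>| right_opts G" for x
    using that by (cases "x = g") (auto simp: game_gt_def intro: game_ge_trans)
  ultimately have "good_option G g" "h \<succeq> g"
    by (auto simp: good_option_def)
  then show thesis by (rule that)
qed

theorem mainTheorem14:
  fixes G G' :: game
  assumes "left_dead_end G"
    and "good_option G G'"
    and "\<And>H. good_option G H \<Longrightarrow> H \<approx> G'"
  shows "\<ell> G = \<ell> G' + 1"
proof -
  have opt: "G' |\<in>| right_opts G"
    using assms(2) by (simp add: good_option_def)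
  \<comment> \<open>Every option dominates a good one, and the good ones all equal
    \<open>G'\<close>.\<close>
  have least: "g \<succeq> G'" if g: "g |\<in>| right_opts G" for g
    using option_ge_good_option[OF g] assms(3) game_ge_trans unfolding game_eq_def by metis
  have G': "left_dead_end G'" using assms(1) opt left_dead_endD(2) by blast
  obtain Bs where Bs: "factorisation G' Bs" "length Bs = \<ell> G'"
    using longest_factorisation[OF G'] .
  have "factorisation G (Bs @ [minus_one])"
    using factorisation_plus[OF Bs(1) factorisation_atom[OF atom_minus_one]]
      eq_least_option_plus_minus_one[OF assms(1) opt least] factorisation_cong by blast
  then have lower: "\<ell> G' + 1 \<le> \<ell> G"
    using factorisation_length_le[OF assms(1)] Bs(2) by fastforce
  obtain As where As: "factorisation G As" "length As = \<ell> G"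
    using longest_factorisation[OF assms(1)] .
  have S: "left_dead_end (sum_list As)" using As(1) by (rule factorisation_left_dead_end)
  have eq: "G \<succeq> sum_list As" "sum_list As \<succeq> G" and atoms: "\<And>A. A \<in> set As \<Longrightarrow> atom A"
    using As(1) by (auto simp: factorisation_def game_eq_def)
  \<comment> \<open>\<open>s\<close> lies below \<open>G'\<close> and also dominates some option of
    \<open>G\<close>, hence \<open>G'\<close>. So \<open>s \<approx> G'\<close>, and a factorisation
    of \<open>s\<close> is one of \<open>G'\<close>.\<close>
  obtain s where s: "s |\<in>| right_opts (sum_list As)" "G' \<succeq> s"
    using left_dead_end_ge_iff[OF assms(1) S] eq(1) opt by blast
  then have "s \<succeq> G'"
    using left_dead_end_ge_iff[OF S assms(1)] eq(2) least game_ge_trans by blast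
  obtain Cs where "factorisation s Cs" "length As \<le> length Cs + 1"
    using sum_of_atoms_option_factorisation[OF atoms s(1)] by blast
  then have "\<ell> G \<le> \<ell> G' + 1"
    using factorisation_length_le[OF G' factorisation_cong] \<open>s \<succeq> G'\<close> s(2) As(2)
    unfolding game_eq_def by fastforce
  with lower show ?thesis by simp
qed

end
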